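(* For all sufficiently large integers $k$, and for each of the two values $b=\frac{1}{2k+1}$ and $b=\frac{k}{(k+1)(2k+1)}$, setting $a=\frac{1-2kb}{2}$, the system $[1/2_s: a,a,b,\ldots,b]$ with two players of weight $a$ and $2k$ players of weight $b$ is a primitive non-trivial Shapley-Shubik fixed point.
   Context: For real numbers $a_1,\ldots,a_N\ge 0$ with sum $1$, $V=[1/2_s: a_1,\ldots,a_N]$ denotes the weighted voting system with $N$ players, player $i$ having weight $a_i$, in which a coalition (set of players) is winning if and only if the sum of the weights of its members strictly exceeds $1/2$. Shapley-Shubik power index: for each of the $N!$ orderings of the players, the pivotal player is the one whose weight, when weights are added up from the beginning of the ordering, first makes the partial sum strictly exceed $1/2$. The Shapley-Shubik index of a player is the number of orderings in which it is pivotal divided by $N!$. Let $SS(V)$ be the tuple of Shapley-Shubik indices of players $1,\ldots,N$. $V$ is a Shapley-Shubik fixed point if $SS(V)=(a_1,\ldots,a_N)$. A fixed point is primitive if no player $i$ has $a_i=0$. A fixed point is non-trivial if not all players have the same power. *)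

theory Defs
  imports Complex_Main "HOL-Combinatorics.Multiset_Permutations"
begin

text \<open>
  The system \<open>[1/2_s: a_1, \<dots>, a_N]\<close> is represented by its list of weights; the players are the
  list indices \<open>0, \<dots>, N - 1\<close>. The quota is always \<open>1/2\<close>, to be strictly exceeded.
\<close>

definition weighted_voting_system :: "real list \<Rightarrow> bool" where
  "weighted_voting_system ws \<longleftrightarrow> (\<forall>w\<in>set ws. w \<ge> 0) \<and> sum_list ws = 1"

definition players :: "real list \<Rightarrow> nat set" where
  "players ws = {..<length ws}"

definition winning :: "real list \<Rightarrow> nat set \<Rightarrow> bool" where
  "winning ws S \<longleftrightarrow> (\<Sum>i\<in>S. ws ! i) > 1 / 2"

text \<open>
  An ordering of the players is a duplicate-free list of all of them. Since it has no duplicates,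
  the partial sum of the weights of its first \<open>m\<close> entries is the weight of the coalition
  \<open>set (take m xs)\<close>.
\<close>

definition pivotal :: "real list \<Rightarrow> nat list \<Rightarrow> nat \<Rightarrow> bool" where
  "pivotal ws xs i \<longleftrightarrow>
     (\<exists>j<length xs. xs ! j = i \<and> winning ws (set (take (Suc j) xs)) \<and>
        (\<forall>m\<le>j. \<not> winning ws (set (take m xs))))"

definition shapley_shubik_index :: "real list \<Rightarrow> nat \<Rightarrow> real" where
  "shapley_shubik_index ws i =
     real (card {xs \<in> permutations_of_set (players ws). pivotal ws xs i}) / fact (length ws)"

definition shapley_shubik :: "real list \<Rightarrow> real list" where
  "shapley_shubik ws = map (shapley_shubik_index ws) [0..<length ws]"

definition ss_fixed_point :: "real list \<Rightarrow> bool" where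
  "ss_fixed_point ws \<longleftrightarrow> weighted_voting_system ws \<and> shapley_shubik ws = ws"

definition primitive_ss_fixed_point :: "real list \<Rightarrow> bool" where
  "primitive_ss_fixed_point ws \<longleftrightarrow> ss_fixed_point ws \<and> (\<forall>i\<in>players ws. ws ! i \<noteq> 0)"

definition nontrivial_ss_fixed_point :: "real list \<Rightarrow> bool" where
  "nontrivial_ss_fixed_point ws \<longleftrightarrow> ss_fixed_point ws \<and>
     \<not> (\<forall>i\<in>players ws. \<forall>j\<in>players ws.
          shapley_shubik_index ws i = shapley_shubik_index ws j)"

end

theory Submission
  imports Defs
begin

text \<open>
  Whether the first heavy player is pivotal depends only on its position \<open>p\<close> and on the position
  \<open>q\<close> of the second heavy player. All pairs \<open>(p, q)\<close> with \<open>p \<noteq> q\<close> are equally likely, so its index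
  is the number of pivotal pairs divided by \<open>(2k + 2)(2k + 1)\<close>. There are \<open>k + 1\<close> pivotal pairs for
  the first value of \<open>b\<close> and \<open>3k + 1\<close> for the second, and both quotients equal \<open>a\<close>. By symmetry
  and because the indices sum to one, each light player then has index \<open>(1 - 2a)/(2k) = b\<close>.
\<close>

section \<open>Orderings with two prescribed entries\<close>

text \<open>Since \<open>map f\<close> is a bijection of the orderings of \<open>A\<close> onto
  themselves, it carries the first set onto the second. This transports counts along symmetries,
  both for positions and for players of equal weight.\<close>

lemma card_permutations_of_set_relabel:
  assumes "f permutes A"
  shows "card {xs \<in> permutations_of_set A. P (map f xs)} = card {xs \<in> permutations_of_set A. P xs}"
proof -
  have "inj f"
    using assms by (rule permutes_inj)
  have "map f ` permutations_of_set A = permutations_of_set A"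
    using permutations_of_set_image_inj[of f A] assms
    by (simp add: permutes_image permutes_inj_on)
  then have "{xs \<in> permutations_of_set A. P xs}
      = map f ` {xs \<in> permutations_of_set A. P (map f xs)}"
    by (metis Compr_image_eq)
  moreover have "inj_on (map f) {xs \<in> permutations_of_set A. P (map f xs)}"
    using inj_on_subset[OF inj_mapI[OF \<open>inj f\<close>]] by simp
  ultimately show ?thesis
    by (simp add: card_image)
qed

lemma ex_permutes_two_points:
  assumes "x \<in> A" "y \<in> A" "x \<noteq> y" "x' \<in> A" "y' \<in> A" "x' \<noteq> y'"
  shows "\<exists>f. f permutes A \<and> f x = x' \<and> f y = y'"
proof -
  let ?g = "transpose x x'"
  let ?h = "transpose (?g y) y'"
  have g: "?g permutes A"
    using assms by (intro permutes_swap_id)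
  have "?g y \<in> A"
    using g assms by (simp add: permutes_in_image)
  then have "?h permutes A"
    using assms by (intro permutes_swap_id)
  with g have "(?h \<circ> ?g) permutes A"
    by (rule permutes_compose)
  \<comment> \<open>The second transposition must not undo the first: it moves only
    \<open>?g y\<close> and \<open>y'\<close>, and \<open>x'\<close> differs from both.\<close>
  moreover have "?g y \<noteq> x'"
    using assms by (auto simp: transpose_def)
  then have "(?h \<circ> ?g) x = x'" "(?h \<circ> ?g) y = y'"
    using assms by auto
  ultimately show ?thesis
    by blast
qed

text \<open>The orderings split into classes by the ordered pair of distinct entries at
  \<open>p\<close> and \<open>q\<close>. Relabelling carries any class to any other, so all
  \<open>card A * (card A - 1)\<close> classes have the same size.\<close>

lemma card_permutations_of_set_nth2:
  assumes "finite A" "p < card A" "q < card A" "p \<noteq> q" "x \<in> A" "y \<in> A" "x \<noteq> y"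
  shows "card {xs \<in> permutations_of_set A. xs ! p = x \<and> xs ! q = y} * (card A * (card A - 1))
    = fact (card A)"
proof -
  let ?N = "\<lambda>z. {xs \<in> permutations_of_set A. xs ! p = fst z \<and> xs ! q = snd z}"
  let ?D = "SIGMA u:A. A - {u}"
  have len: "length xs = card A" "distinct xs" "set xs = A" if "xs \<in> permutations_of_set A" for xs
    using that by (auto simp: permutations_of_set_def distinct_card)
  have "card (?N (u, v)) = card (?N (x, y))" if uv: "u \<in> A" "v \<in> A" "v \<noteq> u" for u v
  proof -
    obtain f where f: "f permutes A" "f u = x" "f v = y"
      using ex_permutes_two_points[of u A v x y] uv assms by blast
    \<comment> \<open>By injectivity, an ordering shows \<open>(u, v)\<close> at the two positions
      exactly when its relabelling shows \<open>(x, y)\<close>.\<close>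
    have fc: "f c = x \<longleftrightarrow> c = u" "f c = y \<longleftrightarrow> c = v" for c
      using f permutes_inj[OF f(1)] by (auto dest: injD)
    have "?N (u, v) = {xs \<in> permutations_of_set A. map f xs ! p = x \<and> map f xs ! q = y}"
      using assms(2,3) by (intro Collect_cong conj_cong refl) (simp_all add: len fc)
    then show ?thesis
      using card_permutations_of_set_relabel[OF f(1), of "\<lambda>xs. xs ! p = x \<and> xs ! q = y"] by simp
  qed
  then have "card (?N z) = card (?N (x, y))" if "z \<in> ?D" for z
    using that by (cases z) simp
  then have "(\<Sum>z\<in>?D. card (?N z)) = (\<Sum>z\<in>?D. card (?N (x, y)))"
    by (intro sum.cong refl)
  also have "\<dots> = card (?N (x, y)) * (card A * (card A - 1))"
    using assms by simp
  finally have count: "(\<Sum>z\<in>?D. card (?N z)) = card (?N (x, y)) * (card A * (card A - 1))" .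
  have "permutations_of_set A = (\<Union>z\<in>?D. ?N z)"
  proof (intro equalityI subsetI)
    fix xs assume xs: "xs \<in> permutations_of_set A"
    have "(xs ! p, xs ! q) \<in> ?D"
      using len[OF xs] assms nth_mem[of p xs] nth_mem[of q xs] by (auto simp: nth_eq_iff_index_eq)
    then show "xs \<in> (\<Union>z\<in>?D. ?N z)"
      using xs by force
  qed auto
  moreover have "card (\<Union>z\<in>?D. ?N z) = (\<Sum>z\<in>?D. card (?N z))"
    using assms by (intro card_UN_disjoint) (auto simp: prod_eq_iff)
  ultimately show ?thesis
    using count assms by simp
qed

section \<open>Symmetry and total of the indices\<close>

lemma winning_relabel:
  assumes "inj f" "\<And>t. ws ! f t = ws ! t"
  shows "winning ws (f ` S) \<longleftrightarrow> winning ws S"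
  using assms by (simp add: winning_def sum.reindex inj_on_subset[OF \<open>inj f\<close>])

lemma pivotal_relabel:
  assumes "inj f" "\<And>t. ws ! f t = ws ! t"
  shows "pivotal ws (map f xs) (f i) \<longleftrightarrow> pivotal ws xs i"
  unfolding pivotal_def
  by (intro ex_cong1)
    (auto simp: take_map winning_relabel[OF assms] inj_eq[OF \<open>inj f\<close>])

text \<open>Swapping the two players preserves all weights, hence pivotality, and permutes the
  orderings.\<close>

lemma shapley_shubik_index_eq_if_weight_eq:
  assumes "i < length ws" "j < length ws" "ws ! i = ws ! j"
  shows "shapley_shubik_index ws i = shapley_shubik_index ws j"
proof -
  let ?f = "transpose i j"
  have f: "?f permutes players ws"
    using assms by (intro permutes_swap_id) (auto simp: players_def)
  have w: "ws ! ?f t = ws ! t" for t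
    using assms by (simp add: transpose_def)
  have "pivotal ws (map ?f xs) j \<longleftrightarrow> pivotal ws xs i" for xs
    using pivotal_relabel[OF permutes_inj[OF f], of ws xs i] w by simp
  then show ?thesis
    using card_permutations_of_set_relabel[OF f, of "\<lambda>xs. pivotal ws xs j"]
    by (simp add: shapley_shubik_index_def)
qed

text \<open>The pivot is the last member of the shortest winning prefix.\<close>

lemma ex_pivotal:
  assumes "winning ws (set xs)"
  shows "\<exists>i\<in>set xs. pivotal ws xs i"
proof -
  let ?P = "\<lambda>m. winning ws (set (take m xs))"
  define m where "m = Least ?P"
  have "?P (length xs)"
    using assms by simp
  then have win: "?P m" and "m \<le> length xs"
    unfolding m_def by (rule LeastI, rule Least_le)
  have lose: "\<not> ?P l" if "l < m" for l
    using that unfolding m_def by (rule not_less_Least)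
  \<comment> \<open>The empty coalition has weight 0, so the shortest winning prefix is nonempty and
    has a last member.\<close>
  have "\<not> ?P 0"
    by (simp add: winning_def)
  then obtain j where j: "m = Suc j"
    using win by (cases m) simp_all
  have "j < length xs"
    using \<open>m \<le> length xs\<close> j by simp
  moreover have "?P (Suc j)" "\<And>l. l \<le> j \<Longrightarrow> \<not> ?P l"
    using win lose j by simp_all
  ultimately have "pivotal ws xs (xs ! j)"
    unfolding pivotal_def by blast
  then show ?thesis
    using \<open>j < length xs\<close> nth_mem by blast
qed

lemma pivotal_unique:
  assumes "pivotal ws xs i" "pivotal ws xs i'"
  shows "i = i'"
proof -
  obtain j where j: "xs ! j = i" "winning ws (set (take (Suc j) xs))"
      "\<And>m. m \<le> j \<Longrightarrow> \<not> winning ws (set (take m xs))"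
    using assms(1) unfolding pivotal_def by blast
  obtain j' where j': "xs ! j' = i'" "winning ws (set (take (Suc j') xs))"
      "\<And>m. m \<le> j' \<Longrightarrow> \<not> winning ws (set (take m xs))"
    using assms(2) unfolding pivotal_def by blast
  \<comment> \<open>If one position came first, the winning prefix ending there would be among the
    prefixes that lose for the other.\<close>
  have "j = j'"
    using j(2) j'(3)[of "Suc j"] j'(2) j(3)[of "Suc j'"] by linarith
  then show ?thesis
    using j(1) j'(1) by simp
qed

text \<open>Each ordering ends with the winning grand coalition and so has exactly one pivot;
  sorting the orderings by pivot partitions all of them.\<close>

lemma sum_shapley_shubik_index:
  assumes "winning ws (players ws)"
  shows "(\<Sum>i\<in>players ws. shapley_shubik_index ws i) = 1"
proof -
  let ?O = "permutations_of_set (players ws)"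
  have [simp]: "finite (players ws)" "card (players ws) = length ws"
    by (simp_all add: players_def)
  have "?O = (\<Union>i\<in>players ws. {xs \<in> ?O. pivotal ws xs i})"
  proof (intro equalityI subsetI)
    fix xs assume xs: "xs \<in> ?O"
    then have "set xs = players ws"
      by (rule permutations_of_setD)
    then show "xs \<in> (\<Union>i\<in>players ws. {xs \<in> ?O. pivotal ws xs i})"
      using ex_pivotal[of ws xs] assms xs by auto
  qed blast
  moreover have "card (\<Union>i\<in>players ws. {xs \<in> ?O. pivotal ws xs i})
      = (\<Sum>i\<in>players ws. card {xs \<in> ?O. pivotal ws xs i})"
    by (intro card_UN_disjoint) (auto dest: pivotal_unique)
  ultimately have "(\<Sum>i\<in>players ws. card {xs \<in> ?O. pivotal ws xs i}) = fact (length ws)"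
    by simp
  then have "real (\<Sum>i\<in>players ws. card {xs \<in> ?O. pivotal ws xs i}) = fact (length ws)"
    by simp
  then show ?thesis
    by (simp add: shapley_shubik_index_def sum_divide_distrib[symmetric])
qed

section \<open>Pivotality in terms of the positions of the heavy players\<close>

lemma winning_mono:
  assumes "\<forall>w\<in>set ws. w \<ge> 0" "S \<subseteq> T" "T \<subseteq> players ws" "winning ws S"
  shows "winning ws T"
proof -
  have "finite T"
    using assms(3) by (rule finite_subset) (simp add: players_def)
  then have "(\<Sum>i\<in>S. ws ! i) \<le> (\<Sum>i\<in>T. ws ! i)"
    using assms by (intro sum_mono2) (auto simp: players_def)
  then show ?thesis
    using assms(4) by (simp add: winning_def)
qed

text \<open>With nonnegative weights, extending a winning prefix keeps it winning, so losing at
  \<open>p\<close> already implies losing at every shorter prefix.\<close>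

lemma pivotal_nth_iff:
  assumes "\<forall>w\<in>set ws. w \<ge> 0" "xs \<in> permutations_of_set (players ws)" "p < length ws"
  shows "pivotal ws xs (xs ! p) \<longleftrightarrow>
    winning ws (set (take (Suc p) xs)) \<and> \<not> winning ws (set (take p xs))"
proof -
  have xs: "distinct xs" "set xs = players ws" "length xs = length ws"
    using assms(2) distinct_card[of xs] by (auto simp: permutations_of_set_def players_def)
  have "winning ws (set (take p xs))" if "m \<le> p" "winning ws (set (take m xs))" for m
    using winning_mono[OF assms(1) set_take_subset_set_take[OF that(1)] _ that(2)] xs set_take_subset
    by metis
  then show ?thesis
    unfolding pivotal_def using xs assms(3) by (auto simp: nth_eq_iff_index_eq)
qed

text \<open>Every entry is charged \<open>b\<close>, and each heavy player already present
  contributes the correction \<open>a - b\<close>. The coalition weight thus depends only on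
  \<open>m\<close>, \<open>p\<close> and \<open>q\<close>.\<close>

lemma weight_take:
  fixes a b :: real
  assumes "distinct xs" "set xs = {..<2 + n}" "p < 2 + n" "q < 2 + n" "xs ! p = 0" "xs ! q = 1"
    and "m \<le> 2 + n"
  shows "(\<Sum>i\<in>set (take m xs). ([a, a] @ replicate n b) ! i)
    = real m * b + (if p < m then a - b else 0) + (if q < m then a - b else 0)"
proof -
  let ?w = "\<lambda>i. ([a, a] @ replicate n b) ! i"
  have len: "length xs = 2 + n"
    using assms(1,2) distinct_card[of xs] by simp
  have "(\<Sum>i\<in>set (take m xs). ?w i) = (\<Sum>t<m. ?w (xs ! t))"
  proof -
    have "set (take m xs) = (!) xs ` {..<m}"
      using assms(7) len by (simp add: nth_image[symmetric] lessThan_atLeast0)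
    moreover have "inj_on ((!) xs) {..<m}"
      using assms(1,7) len by (auto simp: inj_on_def nth_eq_iff_index_eq)
    ultimately show ?thesis
      by (simp add: sum.reindex)
  qed
  also have "\<dots> = (\<Sum>t<m. b + (if t = p then a - b else 0) + (if t = q then a - b else 0))"
  proof (intro sum.cong refl)
    fix t assume "t \<in> {..<m}"
    then have t: "t < length xs"
      using assms(7) len by simp
    have w: "?w i = b + (if i = 0 then a - b else 0) + (if i = 1 then a - b else 0)"
      if "i < 2 + n" for i
      using that by (auto simp: nth_append nth_Cons split: nat.split)
    have "xs ! t < 2 + n"
      using nth_mem[OF t] assms(2) by simp
    moreover have "xs ! t = 0 \<longleftrightarrow> t = p" "xs ! t = 1 \<longleftrightarrow> t = q"
      using assms t len nth_eq_iff_index_eq[of xs t] by metis+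
    ultimately show "?w (xs ! t) = b + (if t = p then a - b else 0) + (if t = q then a - b else 0)"
      by (simp only: w)
  qed
  also have "\<dots> = real m * b + (if p < m then a - b else 0) + (if q < m then a - b else 0)"
    by (simp add: sum.distrib)
  finally show ?thesis .
qed

text \<open>
  The pairs (position of player 0, position of player 1) for which player 0 is pivotal.
\<close>

definition pivotal_positions :: "nat \<Rightarrow> real \<Rightarrow> real \<Rightarrow> (nat \<times> nat) set" where
  "pivotal_positions n a b = {(p, q). p < n \<and> q < n \<and> p \<noteq> q \<and>
     real p * b + (if q < p then a - b else 0) \<le> 1 / 2 \<and>
     1 / 2 < real p * b + (if q < p then a - b else 0) + a}"

lemma pivotal_0_iff:
  fixes a b :: real
  assumes "a \<ge> 0" "b \<ge> 0" "xs \<in> permutations_of_set {..<2 + n}"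
    and "p < 2 + n" "q < 2 + n" "xs ! p = 0" "xs ! q = 1"
  shows "pivotal ([a, a] @ replicate n b) xs 0 \<longleftrightarrow> (p, q) \<in> pivotal_positions (2 + n) a b"
proof -
  let ?V = "[a, a] @ replicate n b"
  have pl: "players ?V = {..<2 + n}" and nn: "\<forall>w\<in>set ?V. w \<ge> 0"
    using assms by (auto simp: players_def)
  have xs: "distinct xs" "set xs = {..<2 + n}"
    using assms(3) by (auto simp: permutations_of_set_def)
  have "p \<noteq> q"
    using assms(6,7) by auto
  have "pivotal ?V xs 0 \<longleftrightarrow>
      winning ?V (set (take (Suc p) xs)) \<and> \<not> winning ?V (set (take p xs))"
    using pivotal_nth_iff[OF nn, of xs p] assms pl by simp
  \<comment> \<open>The first \<open>p\<close> entries exclude player 0 itself, so only player 1 can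
    contribute a correction. One entry later, \<open>q < Suc p\<close> still means
    \<open>q < p\<close> because \<open>p \<noteq> q\<close>.\<close>
  moreover have "(\<Sum>i\<in>set (take p xs). ?V ! i) = real p * b + (if q < p then a - b else 0)"
    using weight_take[OF xs assms(4-7), of p a b] assms(4) by simp
  moreover have "(\<Sum>i\<in>set (take (Suc p) xs). ?V ! i)
      = real p * b + (if q < p then a - b else 0) + a"
    using weight_take[OF xs assms(4-7), of "Suc p" a b] assms(4) \<open>p \<noteq> q\<close>
    by (simp add: less_Suc_eq algebra_simps)
  ultimately show ?thesis
    using \<open>p \<noteq> q\<close> assms(4,5)
    by (simp only: winning_def pivotal_positions_def mem_Collect_eq case_prod_conv not_less) blast
qed

text \<open>The orderings in which player 0 is pivotal are the disjoint union of the classes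
  \<open>?N z\<close> over the pivotal pairs, and each class has
  \<open>fact (2 + n) / ((2 + n) * (1 + n))\<close> members.\<close>

lemma shapley_shubik_index_0:
  fixes a b :: real
  assumes "a \<ge> 0" "b \<ge> 0"
  shows "shapley_shubik_index ([a, a] @ replicate n b) 0
    = real (card (pivotal_positions (2 + n) a b)) / (real (2 + n) * real (1 + n))"
proof -
  let ?V = "[a, a] @ replicate n b"
  let ?O = "permutations_of_set {..<2 + n}"
  let ?P = "pivotal_positions (2 + n) a b"
  let ?N = "\<lambda>z. {xs \<in> ?O. xs ! fst z = 0 \<and> xs ! snd z = 1}"
  have pl: "players ?V = {..<2 + n}"
    by (auto simp: players_def)
  have len: "length xs = 2 + n" "distinct xs" "set xs = {..<2 + n}" if "xs \<in> ?O" for xs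
    using that distinct_card[of xs] by (auto simp: permutations_of_set_def)
  have fin: "finite ?P"
    by (rule finite_subset[of _ "{..<2 + n} \<times> {..<2 + n}"]) (auto simp: pivotal_positions_def)
  have bounds: "fst z < 2 + n" "snd z < 2 + n" "fst z \<noteq> snd z" if "z \<in> ?P" for z
    using that by (auto simp: pivotal_positions_def)
  have "{xs \<in> ?O. pivotal ?V xs 0} = (\<Union>z\<in>?P. ?N z)"
  proof (intro equalityI subsetI)
    fix xs assume "xs \<in> {xs \<in> ?O. pivotal ?V xs 0}"
    then have xs: "xs \<in> ?O" "pivotal ?V xs 0"
      by auto
    have "0 \<in> set xs" "1 \<in> set xs"
      using len(3)[OF xs(1)] by auto
    then obtain p q where pq: "p < 2 + n" "q < 2 + n" "xs ! p = 0" "xs ! q = 1"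
      using len(1)[OF xs(1)] by (metis in_set_conv_nth)
    then have "(p, q) \<in> ?P"
      using pivotal_0_iff[OF assms xs(1) pq] xs(2) by blast
    then show "xs \<in> (\<Union>z\<in>?P. ?N z)"
      using xs(1) pq by force
  next
    fix xs assume "xs \<in> (\<Union>z\<in>?P. ?N z)"
    then obtain z where z: "z \<in> ?P" "xs \<in> ?O" "xs ! fst z = 0" "xs ! snd z = 1"
      by auto
    then show "xs \<in> {xs \<in> ?O. pivotal ?V xs 0}"
      using pivotal_0_iff[OF assms z(2) bounds(1,2)[OF z(1)] z(3,4)] by simp
  qed
  moreover have "card (\<Union>z\<in>?P. ?N z) = (\<Sum>z\<in>?P. card (?N z))"
  proof (intro card_UN_disjoint fin ballI impI)
    fix z z' assume zz: "z \<in> ?P" "z' \<in> ?P" "z \<noteq> z'"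
    show "?N z \<inter> ?N z' = {}"
    proof (rule ccontr)
      assume "?N z \<inter> ?N z' \<noteq> {}"
      then obtain xs where xs: "xs \<in> ?O" "xs ! fst z = xs ! fst z'" "xs ! snd z = xs ! snd z'"
        by fastforce
      then have "fst z = fst z'" "snd z = snd z'"
        using len[OF xs(1)] bounds zz by (metis nth_eq_iff_index_eq)+
      then show False
        using zz(3) by (simp add: prod_eq_iff)
    qed
  qed auto
  ultimately have "card {xs \<in> ?O. pivotal ?V xs 0} * ((2 + n) * (1 + n))
      = (\<Sum>z\<in>?P. card (?N z) * ((2 + n) * (1 + n)))"
    by (simp only: sum_distrib_right)
  also have "\<dots> = (\<Sum>z\<in>?P. fact (2 + n))"
  proof (intro sum.cong refl)
    fix z assume z: "z \<in> ?P"
    show "card (?N z) * ((2 + n) * (1 + n)) = fact (2 + n)"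
      using card_permutations_of_set_nth2[of "{..<2 + n}" "fst z" "snd z" 0 1] bounds[OF z]
      by simp
  qed
  finally have "card {xs \<in> ?O. pivotal ?V xs 0} * ((2 + n) * (1 + n)) = card ?P * fact (2 + n)"
    by simp
  then have "real (card {xs \<in> ?O. pivotal ?V xs 0} * ((2 + n) * (1 + n)))
      = real (card ?P * fact (2 + n))"
    by (simp only:)
  then have eq: "real (card {xs \<in> ?O. pivotal ?V xs 0}) * (real (2 + n) * real (1 + n))
      = real (card ?P) * fact (2 + n)"
    by (simp only: of_nat_mult of_nat_fact)
  have "length ?V = 2 + n"
    by simp
  then have "shapley_shubik_index ?V 0
      = real (card {xs \<in> ?O. pivotal ?V xs 0}) / fact (2 + n)"
    unfolding shapley_shubik_index_def pl by (simp only:)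
  also have "\<dots> = real (card ?P) / (real (2 + n) * real (1 + n))"
    using eq by (subst frac_eq_eq) (simp_all del: fact_Suc)
  finally show ?thesis .
qed

section \<open>A fixed-point criterion by counting pivotal pairs\<close>

text \<open>The count fixes the index of player 0, symmetry gives that of player 1, and the total 1
  leaves \<open>b\<close> for each light player. Positivity of \<open>a\<close> and \<open>b\<close>
  yields primitivity, and \<open>a \<noteq> b\<close> yields non-triviality.\<close>

lemma ss_fixed_point_two_heavy:
  fixes a b :: real
  assumes "a > 0" "b > 0" "a \<noteq> b" "n > 0" "2 * a + real n * b = 1"
    and "real (card (pivotal_positions (2 + n) a b)) = a * (real (2 + n) * real (1 + n))"
  shows "primitive_ss_fixed_point ([a, a] @ replicate n b) \<and>
    nontrivial_ss_fixed_point ([a, a] @ replicate n b)"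
proof -
  let ?V = "[a, a] @ replicate n b"
  let ?ss = "shapley_shubik_index ?V"
  have nth: "?V ! i = (if i < 2 then a else b)" if "i < 2 + n" for i
    using that by (auto simp: nth_append nth_Cons split: nat.split)
  have pl: "players ?V = {..<2 + n}"
    by (auto simp: players_def)
  have total: "(\<Sum>i\<in>players ?V. ?V ! i) = 1"
  proof -
    have "(\<Sum>i\<in>players ?V. ?V ! i) = sum_list ?V"
      by (simp only: players_def lessThan_atLeast0 sum_list_sum_nth)
    then show ?thesis
      using assms(5) by (simp add: sum_list_replicate)
  qed
  have "?ss 0 = a * (real (2 + n) * real (1 + n)) / (real (2 + n) * real (1 + n))"
    using shapley_shubik_index_0[of a b n] assms(1,2,6) by (simp only: less_imp_le)
  then have "?ss 0 = a"
    by (simp only: nonzero_mult_div_cancel_right mult_eq_0_iff of_nat_eq_0_iff) simp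
  then have heavy: "?ss i = a" if "i < 2" for i
    using shapley_shubik_index_eq_if_weight_eq[of i ?V 0] nth[of i] nth[of 0] that by simp
  \<comment> \<open>Player 2 is the first light player; it exists because
    \<open>n > 0\<close>.\<close>
  have light: "?ss i = ?ss 2" if "2 \<le> i" "i < 2 + n" for i
    using shapley_shubik_index_eq_if_weight_eq[of i ?V 2] nth[of i] nth[of 2] that assms(4) by simp
  have "winning ?V (players ?V)"
    by (simp only: winning_def total)
  then have "1 = (\<Sum>i<2 + n. ?ss i)"
    using sum_shapley_shubik_index[of ?V] pl by simp
  also have "\<dots> = (\<Sum>i<2. ?ss i) + (\<Sum>i\<in>{2..<2 + n}. ?ss i)"
  proof -
    have split: "{..<2 + n} = {..<2} \<union> {2..<2 + n}"
      by auto
    show ?thesis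
      unfolding split by (rule sum.union_disjoint) auto
  qed
  finally have "(\<Sum>i<2. ?ss i) + (\<Sum>i\<in>{2..<2 + n}. ?ss i) = 1"
    by (rule sym)
  moreover have "(\<Sum>i<2. ?ss i) = (\<Sum>i<2::nat. a)"
    by (intro sum.cong refl heavy) simp
  moreover have "(\<Sum>i\<in>{2..<2 + n}. ?ss i) = (\<Sum>i\<in>{2..<2 + n}. ?ss 2)"
    by (intro sum.cong refl light) simp_all
  ultimately have "2 * a + real n * ?ss 2 = 1"
    by simp
  then have "real n * ?ss 2 = real n * b"
    using assms(5) by linarith
  then have "?ss 2 = b"
    using assms(4) by simp
  then have index: "?ss i = ?V ! i" if "i < 2 + n" for i
    using that heavy[of i] light[of i] nth[of i] by simp
  have "shapley_shubik ?V = ?V"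
    by (rule nth_equalityI)
      (simp_all add: shapley_shubik_def index del: append_Cons append_Nil upt_Suc)
  moreover have "weighted_voting_system ?V"
    using assms by (auto simp: weighted_voting_system_def sum_list_replicate)
  ultimately have "ss_fixed_point ?V"
    by (simp add: ss_fixed_point_def)
  moreover have "\<forall>i\<in>players ?V. ?V ! i \<noteq> 0"
    using assms(1,2) nth pl by simp
  moreover have "?ss 0 \<noteq> ?ss 2" "0 \<in> players ?V" "2 \<in> players ?V"
    using heavy[of 0] \<open>?ss 2 = b\<close> assms(3,4) pl by simp_all
  ultimately show ?thesis
    unfolding primitive_ss_fixed_point_def nontrivial_ss_fixed_point_def by blast
qed

section \<open>The pivotal pairs for the two values of \<open>b\<close>\<close>

text \<open>In units of \<open>a\<close>, a heavy player weighs 1, a light one 2, and the quota is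
  the odd number \<open>2 * k + 1\<close>. All comparisons are then between integers.\<close>

lemma pivotal_positions_small:
  assumes "b = 2 * a" "1 / 2 = a * (2 * real k + 1)"
  shows "pivotal_positions (2 + 2 * k) a b = {k + 1} \<times> {..k}"
proof -
  have "a > 0"
    using assms(2) zero_less_mult_pos2[of a "2 * real k + 1"] by simp
  \<comment> \<open>Here the second heavy player precedes the first. In units of \<open>a\<close>
    the condition is \<open>2 * p - 1 <= 2 * k + 1 < 2 * p\<close>.\<close>
  have before: "real p * b + (a - b) \<le> 1 / 2 \<and> 1 / 2 < real p * b + (a - b) + a \<longleftrightarrow> p = k + 1" for p
  proof -
    have "real p * b + (a - b) = a * (2 * real p - 1)" "real p * b + (a - b) + a = a * (2 * real p)"
      using assms(1) by (simp_all add: algebra_simps)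
    then show ?thesis
      using \<open>a > 0\<close> unfolding assms(2) by auto
  qed
  \<comment> \<open>If the second heavy player comes later, the prefix weight \<open>2 * p\<close>
    is even, and adding 1 cannot carry it past an odd quota that it does not exceed.\<close>
  have after: "\<not> (real p * b \<le> 1 / 2 \<and> 1 / 2 < real p * b + a)" for p
  proof -
    have "real p * b = a * (2 * real p)" "real p * b + a = a * (2 * real p + 1)"
      using assms(1) by (simp_all add: algebra_simps)
    then show ?thesis
      using \<open>a > 0\<close> unfolding assms(2) by auto
  qed
  show ?thesis
    unfolding pivotal_positions_def using before after by (auto split: if_splits)
qed

text \<open>In units of \<open>c\<close>, the weights are \<open>3 * k + 1\<close> and
  \<open>2 * k\<close>, and the quota is \<open>(k + 1) * (2 * k + 1)\<close>. Position
  \<open>k + 1\<close> is pivotal wherever the other heavy player stands, position \<open>k\<close>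
  only if that player came earlier.\<close>

lemma pivotal_positions_large:
  assumes "k > 1" "c > 0" "a = c * (3 * real k + 1)" "b = c * (2 * real k)"
    and "1 / 2 = c * ((real k + 1) * (2 * real k + 1))"
  shows "pivotal_positions (2 + 2 * k) a b
    = {k + 1} \<times> ({..<2 + 2 * k} - {k + 1}) \<union> {k} \<times> {..<k}"
proof -
  \<comment> \<open>The comparisons contain the product of \<open>k\<close> and \<open>p\<close>.
    Each range of \<open>p\<close> away from \<open>k\<close> and \<open>k + 1\<close> is paired
    with a bound on this product, which makes the remaining arithmetic linear in the
    monomials.\<close>
  have cases: "(p < k \<and> real k * (real p + 1) \<le> real k * real k) \<or> p = k \<or> p = k + 1
      \<or> (p > k + 1 \<and> real k * (real k + 2) \<le> real k * real p)" for p
  proof -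
    have "p < k \<or> p = k \<or> p = k + 1 \<or> p > k + 1"
      by linarith
    then show ?thesis
      by (auto intro!: mult_left_mono)
  qed
  have before: "real p * b + (a - b) \<le> 1 / 2 \<and> 1 / 2 < real p * b + (a - b) + a
      \<longleftrightarrow> p = k \<or> p = k + 1" for p
  proof -
    have "real p * b + (a - b) = c * (2 * (real k * real p) + real k + 1)"
         "real p * b + (a - b) + a = c * (2 * (real k * real p) + 4 * real k + 2)"
      using assms(3,4) by (simp_all add: algebra_simps)
    then have "real p * b + (a - b) \<le> 1 / 2 \<and> 1 / 2 < real p * b + (a - b) + a \<longleftrightarrow>
        2 * (real k * real p) + real k + 1 \<le> (real k + 1) * (2 * real k + 1) \<and>
        (real k + 1) * (2 * real k + 1) < 2 * (real k * real p) + 4 * real k + 2"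
      using assms(2) unfolding assms(5) by simp
    then show ?thesis
      using cases[of p] assms(1) by (auto simp: algebra_simps)
  qed
  \<comment> \<open>The value \<open>p = k + 2\<close> is excluded because
    \<open>2 * k * (k + 2)\<close> exceeds the quota by \<open>k - 1\<close>, which is positive for
    \<open>k > 1\<close>.\<close>
  have after: "real p * b \<le> 1 / 2 \<and> 1 / 2 < real p * b + a \<longleftrightarrow> p = k + 1" for p
  proof -
    have "real p * b = c * (2 * (real k * real p))"
         "c * (2 * (real k * real p)) + a = c * (2 * (real k * real p) + 3 * real k + 1)"
      using assms(3,4) by (simp_all add: algebra_simps)
    then have "real p * b \<le> 1 / 2 \<and> 1 / 2 < real p * b + a \<longleftrightarrow>
        2 * (real k * real p) \<le> (real k + 1) * (2 * real k + 1) \<and>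
        (real k + 1) * (2 * real k + 1) < 2 * (real k * real p) + 3 * real k + 1"
      using assms(2) by (simp only: assms(5) mult_le_cancel_left_pos mult_less_cancel_left_pos)
    then show ?thesis
      using cases[of p] assms(1) by (auto simp: algebra_simps)
  qed
  show ?thesis
    unfolding pivotal_positions_def using before after by (auto split: if_splits)
qed

section \<open>Both families are fixed points\<close>

theorem mainTheorem5:
  "\<forall>\<^sub>F k :: nat in at_top.
     \<forall>b \<in> {1 / (2 * real k + 1), real k / ((real k + 1) * (2 * real k + 1))}.
       let a = (1 - 2 * real k * b) / 2;
           V = [a, a] @ replicate (2 * k) b
       in primitive_ss_fixed_point V \<and> nontrivial_ss_fixed_point V"
\<comment> \<open>The threshold \<open>k > 1\<close> is the hypothesis of
  \<open>pivotal_positions_large\<close>.\<close>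
proof (rule eventually_mono[OF eventually_gt_at_top[of 1]], intro ballI)
  fix k :: nat and b :: real
  assume k: "1 < k"
    and b: "b \<in> {1 / (2 * real k + 1), real k / ((real k + 1) * (2 * real k + 1))}"
  define a where "a = (1 - 2 * real k * b) / 2"
  have players: "real (2 + 2 * k) = 2 * (real k + 1)" "real (1 + 2 * k) = 2 * real k + 1"
    by simp_all
  have total: "2 * a + real (2 * k) * b = 1"
    by (simp add: a_def field_simps)
  have "primitive_ss_fixed_point ([a, a] @ replicate (2 * k) b) \<and>
      nontrivial_ss_fixed_point ([a, a] @ replicate (2 * k) b)"
    using b
  proof (elim insertE emptyE)
    assume b: "b = 1 / (2 * real k + 1)"
    then have "b * (2 * real k + 1) = 1"
      by simp
    then have "b = 2 * a"
      using total by (simp add: algebra_simps)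
    with \<open>b * (2 * real k + 1) = 1\<close> have a: "b = 2 * a" "1 / 2 = a * (2 * real k + 1)"
      by simp_all
    have "b > 0"
      unfolding b by simp
    \<comment> \<open>Grouping the factor \<open>a * (2 * real k + 1)\<close>, which is 1/2, leaves
      \<open>k + 1\<close>, the size of the rectangle of pivotal pairs.\<close>
    have "a * (2 * (real k + 1) * (2 * real k + 1)) = a * (2 * real k + 1) * (2 * (real k + 1))"
      by simp
    also have "\<dots> = real k + 1"
      unfolding a(2)[symmetric] by simp
    finally have "real (card (pivotal_positions (2 + 2 * k) a b))
        = a * (real (2 + 2 * k) * real (1 + 2 * k))"
      unfolding pivotal_positions_small[OF a] players by (simp add: card_cartesian_product mult.assoc)
    then show ?thesis
      using \<open>b > 0\<close> a(1) k total by (intro ss_fixed_point_two_heavy) simp_all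
  next
    assume b: "b = real k / ((real k + 1) * (2 * real k + 1))"
    define d where "d = (real k + 1) * (2 * real k + 1)"
    \<comment> \<open>This unit turns \<open>a\<close>, \<open>b\<close> and the quota 1/2 into the
      integers \<open>3 * k + 1\<close>, \<open>2 * k\<close> and \<open>d\<close>.\<close>
    define c where "c = 1 / (2 * d)"
    have "d > 0"
      by (simp add: d_def)
    then have c: "c > 0" "b = c * (2 * real k)" "1 / 2 = c * d"
      using b by (simp_all add: c_def d_def[symmetric])
    have "a = c * d - real k * b"
      using c(3) by (simp add: a_def)
    then have a: "a = c * (3 * real k + 1)"
      unfolding c(2) d_def by (simp add: algebra_simps)
    \<comment> \<open>The two disjoint pieces contribute \<open>2 * k + 1\<close> pairs with
      \<open>p = k + 1\<close> and \<open>k\<close> pairs with \<open>p = k\<close>.\<close>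
    have positions: "card (pivotal_positions (2 + 2 * k) a b) = 3 * k + 1"
      unfolding pivotal_positions_large[OF k c(1) a c(2) c(3)[unfolded d_def]]
      by (subst card_Un_disjoint) (auto simp: card_cartesian_product)
    have "a * (2 * (real k + 1) * (2 * real k + 1)) = c * d * (2 * (3 * real k + 1))"
      unfolding a d_def by (simp add: algebra_simps)
    also have "\<dots> = 3 * real k + 1"
      unfolding c(3)[symmetric] by simp
    finally have "real (card (pivotal_positions (2 + 2 * k) a b))
        = a * (real (2 + 2 * k) * real (1 + 2 * k))"
      unfolding positions players by (simp add: mult.assoc)
    moreover have "a > 0" "b > 0" "a \<noteq> b"
      using c(1) k unfolding a c(2) by (simp_all add: add_pos_pos)
    ultimately show ?thesis
      using k total by (intro ss_fixed_point_two_heavy) simp_all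
  qed
  then show "let a = (1 - 2 * real k * b) / 2; V = [a, a] @ replicate (2 * k) b
       in primitive_ss_fixed_point V \<and> nontrivial_ss_fixed_point V"
    by (simp add: a_def Let_def)
qed

end
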